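(* (1) Let $\varphi_1,\varphi_2\in\boldsymbol{\varPsi}(\mathcal{B})$ be nonnegative with $\varphi_1(J)=\varphi_2(J)=0$. Let $\widetilde{\varphi}_1$ be a super-Choquet extension of $\varphi_1$, and let $\widetilde{\varphi}_2$ be a sub-Choquet extension of $\varphi_2$ (or, if $\varphi_2$ is submodular, a one-homogeneous convex extension of $\varphi_2$). Then $$\inf_{A\in\mathcal{B},\ \varphi_2(A)>0}\frac{\varphi_1(A)}{\varphi_2(A)}=\inf_{f\in \mathrm{Bd},\ \widehat{\varphi}_2(f)>0}\frac{\widehat{\varphi}_1(f)}{\widehat{\varphi}_2(f)}=\inf_{f\in \mathrm{Bd},\ \widetilde{\varphi}_2(f)>0}\frac{\widetilde{\varphi}_1(f)}{\widetilde{\varphi}_2(f)}.$$ (2) Let $\psi_1,\psi_2\in\boldsymbol{\varPsi}(\mathcal{B}_2)$ be nonnegative. Let $\widetilde{\psi}_1$ be a super-Choquet extension of $\psi_1$, and let $\widetilde{\psi}_2$ be a sub-Choquet extension of $\psi_2$ (or, if $\psi_2$ is bisubmodular, a one-homogeneous convex extension of $\psi_2$). Then $$\inf_{(A,A')\in\mathcal{B}_2,\ \psi_2(A,A')>0}\frac{\psi_1(A,A')}{\psi_2(A,A')}=\inf_{f\in \mathrm{Bd},\ \widehat{\psi}_2(f)>0}\frac{\widehat{\psi}_1(f)}{\widehat{\psi}_2(f)}=\inf_{f\in \mathrm{Bd},\ \widetilde{\psi}_2(f)>0}\frac{\widetilde{\psi}_1(f)}{\widetilde{\psi}_2(f)}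.$$
   Context: $(J,\mathcal{B})$ is a set with a sigma-algebra; $\mathrm{Bd}$ is the Banach space of bounded measurable functions $f:J\to\mathbb{R}$ with the supremum norm; $\mathcal{B}_2=\{(B,B')\in\mathcal{B}\times\mathcal{B}:B\cap B'=\varnothing\}$; $1_A$ is the indicator function of $A$; $\{f\ge t\}=\{x\in J: f(x)\ge t\}$ and $\{f\le -t\}$ is defined similarly. $\boldsymbol{\varPsi}(\mathcal{B})$ is the set of all $\varphi:\mathcal{B}\to\mathbb{R}$ such that for every $f\in\mathrm{Bd}$ the function $t\mapsto\varphi\{f\ge t\}$ is Lebesgue integrable on $[\inf f,\infty)$. The Choquet extension is $\widehat{\varphi}(f)=\int_{\inf f}^\infty\varphi\{f\ge t\}\,dt+\varphi(J)\inf f$. $\boldsymbol{\varPsi}(\mathcal{B}_2)$ is the set of all $\psi:\mathcal{B}_2\to\mathbb{R}$ such that for every $f\in\mathrm{Bd}$ the function $t\mapsto\psi(\{f\ge t\},\{f\le -t\})$ is Lebesgue integrable on $(0,\infty)$. The disjoint-pair Choquet extension is $\widehat{\psi}(f)=\int_0^\infty\psi(\{f\ge t\},\{f\le -t\})\,dt$. $\widetilde{\varphi}:\mathrm{Bd}\to\mathbb{R}$ is a sub-Choquet (resp. super-Choquet) extension of $\varphi$ if $\widetilde{\varphi}(1_A)=\varphi(A)$ for all $A\in\mathcal{B}$ and $\widetilde{\varphi}(f)\le\widehat{\varphi}(f)$ (resp. $\ge$) for all $f\in\mathrm{Bd}$. It is a one-homogeneous convex extension of $\varphi$ if it is lower semicontinuous,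 (positively) one-homogeneous, convex and even, and $\widetilde{\varphi}(1_A)=\varphi(A)$ for all $A\in\mathcal{B}$. $\widetilde{\psi}:\mathrm{Bd}\to\mathbb{R}$ is a sub-Choquet (resp. super-Choquet) extension of $\psi$ if $\widetilde{\psi}(1_A-1_{A'})=\psi(A,A')$ for all $(A,A')\in\mathcal{B}_2$ and $\widetilde{\psi}(f)\le\widehat{\psi}(f)$ (resp. $\ge$) for all $f\in\mathrm{Bd}$. It is a one-homogeneous convex extension of $\psi$ if it is lower semicontinuous, (positively) one-homogeneous and convex, and $\widetilde{\psi}(1_A-1_{A'})=\psi(A,A')$ for all $(A,A')\in\mathcal{B}_2$. $\varphi$ is submodular if $\varphi(A)+\varphi(B)\ge\varphi(A\cup B)+\varphi(A\cap B)$ for all $A,B\in\mathcal{B}$. $\psi$ is bisubmodular if for all $(A,A'),(B,B')\in\mathcal{B}_2$, $\psi(A,A')+\psi(B,B')\ge\psi((A\cup B)\setminus(A'\cup B'),(A'\cup B')\setminus(A\cup B))+\psi(A\cap B,A'\cap B')$. The infimum of the empty set is $+\infty$. *)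

theory Defs
  imports "HOL-Analysis.Analysis"
begin

text \<open>
  The measurable space \<open>(J, \<B>)\<close> is rendered as the pair \<open>(space M, sets M)\<close> of a value
  \<open>M :: 'a measure\<close>; its measure is never used.  Functions on \<open>J\<close> are total functions that are
  \<open>undefined\<close> outside \<open>space M\<close> (\<open>extensional\<close>), so that equality of elements of \<open>Bd M\<close> is
  equality of functions on \<open>J\<close> and a functional on \<open>Bd M\<close> sees nothing outside \<open>J\<close>.  Set
  functions and functionals are total as well, but only their values on \<open>sets M\<close>, \<open>B2 M\<close> and
  \<open>Bd M\<close>, respectively, are ever constrained or used.
\<close>

definition Bd :: "'a measure \<Rightarrow> ('a \<Rightarrow> real) set" where
  "Bd M = {f \<in> extensional (space M). f \<in> borel_measurable M \<and> bounded (f ` space M)}"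

definition sup_norm :: "'a measure \<Rightarrow> ('a \<Rightarrow> real) \<Rightarrow> real" where
  "sup_norm M f = (SUP x\<in>space M. \<bar>f x\<bar>)"

definition B2 :: "'a measure \<Rightarrow> ('a set \<times> 'a set) set" where
  "B2 M = {(A, A'). A \<in> sets M \<and> A' \<in> sets M \<and> A \<inter> A' = {}}"

definition ind :: "'a measure \<Rightarrow> 'a set \<Rightarrow> 'a \<Rightarrow> real" where
  "ind M A = restrict (indicator A) (space M)"

definition ind_diff :: "'a measure \<Rightarrow> 'a set \<Rightarrow> 'a set \<Rightarrow> 'a \<Rightarrow> real" where
  "ind_diff M A A' = (\<lambda>x\<in>space M. indicator A x - indicator A' x)"

definition upper_set :: "'a measure \<Rightarrow> ('a \<Rightarrow> real) \<Rightarrow> real \<Rightarrow> 'a set" where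
  "upper_set M f t = {x \<in> space M. f x \<ge> t}"

definition lower_set :: "'a measure \<Rightarrow> ('a \<Rightarrow> real) \<Rightarrow> real \<Rightarrow> 'a set" where
  "lower_set M f t = {x \<in> space M. f x \<le> t}"

text \<open>For \<open>space M = {}\<close> this is an unspecified real; integrability then still forces
  \<open>\<phi> {} = 0\<close> in \<open>Psi\<close> below, so that the Choquet extension is \<open>0\<close>.\<close>

definition inf_fun :: "'a measure \<Rightarrow> ('a \<Rightarrow> real) \<Rightarrow> real" where
  "inf_fun M f = (INF x\<in>space M. f x)"

definition Psi :: "'a measure \<Rightarrow> ('a set \<Rightarrow> real) set" where
  "Psi M = {\<phi>. \<forall>f\<in>Bd M. set_integrable lebesgue {inf_fun M f..} (\<lambda>t. \<phi> (upper_set M f t))}"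

definition choquet :: "'a measure \<Rightarrow> ('a set \<Rightarrow> real) \<Rightarrow> ('a \<Rightarrow> real) \<Rightarrow> real" where
  "choquet M \<phi> f =
    (LINT t:{inf_fun M f..}|lebesgue. \<phi> (upper_set M f t)) + \<phi> (space M) * inf_fun M f"

definition Psi2 :: "'a measure \<Rightarrow> ('a set \<times> 'a set \<Rightarrow> real) set" where
  "Psi2 M = {\<psi>. \<forall>f\<in>Bd M.
    set_integrable lebesgue {0<..} (\<lambda>t. \<psi> (upper_set M f t, lower_set M f (- t)))}"

definition choquet2 :: "'a measure \<Rightarrow> ('a set \<times> 'a set \<Rightarrow> real) \<Rightarrow> ('a \<Rightarrow> real) \<Rightarrow> real" where
  "choquet2 M \<psi> f = (LINT t:{0<..}|lebesgue. \<psi> (upper_set M f t, lower_set M f (- t)))"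

definition lsc_on_Bd :: "'a measure \<Rightarrow> (('a \<Rightarrow> real) \<Rightarrow> real) \<Rightarrow> bool" where
  "lsc_on_Bd M F \<longleftrightarrow>
    (\<forall>f\<in>Bd M. \<forall>a<F f. \<exists>\<delta>>0. \<forall>g\<in>Bd M. sup_norm M (\<lambda>x. g x - f x) < \<delta> \<longrightarrow> a < F g)"

definition one_homogeneous :: "'a measure \<Rightarrow> (('a \<Rightarrow> real) \<Rightarrow> real) \<Rightarrow> bool" where
  "one_homogeneous M F \<longleftrightarrow> (\<forall>f\<in>Bd M. \<forall>c\<ge>0. F (\<lambda>x\<in>space M. c * f x) = c * F f)"

definition convex_on_Bd :: "'a measure \<Rightarrow> (('a \<Rightarrow> real) \<Rightarrow> real) \<Rightarrow> bool" where
  "convex_on_Bd M F \<longleftrightarrow>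
    (\<forall>f\<in>Bd M. \<forall>g\<in>Bd M. \<forall>u\<in>{0..1}.
      F (\<lambda>x\<in>space M. (1 - u) * f x + u * g x) \<le> (1 - u) * F f + u * F g)"

definition even_on_Bd :: "'a measure \<Rightarrow> (('a \<Rightarrow> real) \<Rightarrow> real) \<Rightarrow> bool" where
  "even_on_Bd M F \<longleftrightarrow> (\<forall>f\<in>Bd M. F (\<lambda>x\<in>space M. - f x) = F f)"

definition extends :: "'a measure \<Rightarrow> ('a set \<Rightarrow> real) \<Rightarrow> (('a \<Rightarrow> real) \<Rightarrow> real) \<Rightarrow> bool" where
  "extends M \<phi> F \<longleftrightarrow> (\<forall>A\<in>sets M. F (ind M A) = \<phi> A)"

definition sub_choquet_ext ::
    "'a measure \<Rightarrow> ('a set \<Rightarrow> real) \<Rightarrow> (('a \<Rightarrow> real) \<Rightarrow> real) \<Rightarrow> bool" where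
  "sub_choquet_ext M \<phi> F \<longleftrightarrow> extends M \<phi> F \<and> (\<forall>f\<in>Bd M. F f \<le> choquet M \<phi> f)"

definition super_choquet_ext ::
    "'a measure \<Rightarrow> ('a set \<Rightarrow> real) \<Rightarrow> (('a \<Rightarrow> real) \<Rightarrow> real) \<Rightarrow> bool" where
  "super_choquet_ext M \<phi> F \<longleftrightarrow> extends M \<phi> F \<and> (\<forall>f\<in>Bd M. F f \<ge> choquet M \<phi> f)"

definition one_homogeneous_convex_ext ::
    "'a measure \<Rightarrow> ('a set \<Rightarrow> real) \<Rightarrow> (('a \<Rightarrow> real) \<Rightarrow> real) \<Rightarrow> bool" where
  "one_homogeneous_convex_ext M \<phi> F \<longleftrightarrow>
    lsc_on_Bd M F \<and> one_homogeneous M F \<and> convex_on_Bd M F \<and> even_on_Bd M F \<and> extends M \<phi> F"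

definition extends2 ::
    "'a measure \<Rightarrow> ('a set \<times> 'a set \<Rightarrow> real) \<Rightarrow> (('a \<Rightarrow> real) \<Rightarrow> real) \<Rightarrow> bool" where
  "extends2 M \<psi> F \<longleftrightarrow> (\<forall>(A, A')\<in>B2 M. F (ind_diff M A A') = \<psi> (A, A'))"

definition sub_choquet_ext2 ::
    "'a measure \<Rightarrow> ('a set \<times> 'a set \<Rightarrow> real) \<Rightarrow> (('a \<Rightarrow> real) \<Rightarrow> real) \<Rightarrow> bool" where
  "sub_choquet_ext2 M \<psi> F \<longleftrightarrow> extends2 M \<psi> F \<and> (\<forall>f\<in>Bd M. F f \<le> choquet2 M \<psi> f)"

definition super_choquet_ext2 ::
    "'a measure \<Rightarrow> ('a set \<times> 'a set \<Rightarrow> real) \<Rightarrow> (('a \<Rightarrow> real) \<Rightarrow> real) \<Rightarrow> bool" where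
  "super_choquet_ext2 M \<psi> F \<longleftrightarrow> extends2 M \<psi> F \<and> (\<forall>f\<in>Bd M. F f \<ge> choquet2 M \<psi> f)"

text \<open>Unlike for set functions on \<open>sets M\<close>, evenness is not part of the definition for pairs.\<close>

definition one_homogeneous_convex_ext2 ::
    "'a measure \<Rightarrow> ('a set \<times> 'a set \<Rightarrow> real) \<Rightarrow> (('a \<Rightarrow> real) \<Rightarrow> real) \<Rightarrow> bool" where
  "one_homogeneous_convex_ext2 M \<psi> F \<longleftrightarrow>
    lsc_on_Bd M F \<and> one_homogeneous M F \<and> convex_on_Bd M F \<and> extends2 M \<psi> F"

definition submodular :: "'a measure \<Rightarrow> ('a set \<Rightarrow> real) \<Rightarrow> bool" where
  "submodular M \<phi> \<longleftrightarrow>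
    (\<forall>A\<in>sets M. \<forall>B\<in>sets M. \<phi> A + \<phi> B \<ge> \<phi> (A \<union> B) + \<phi> (A \<inter> B))"

definition bisubmodular :: "'a measure \<Rightarrow> ('a set \<times> 'a set \<Rightarrow> real) \<Rightarrow> bool" where
  "bisubmodular M \<psi> \<longleftrightarrow>
    (\<forall>(A, A')\<in>B2 M. \<forall>(B, B')\<in>B2 M.
      \<psi> (A, A') + \<psi> (B, B') \<ge>
        \<psi> ((A \<union> B) - (A' \<union> B'), (A' \<union> B') - (A \<union> B)) + \<psi> (A \<inter> B, A' \<inter> B'))"

end

theory Submission
  imports Defs
begin

text \<open>
  An inequality \<open>r * \<phi>2 \<le> \<phi>1\<close> between set functions integrates over level sets to one between Choquet
  extensions, and then passes to a super-Choquet extension of \<open>\<phi>1\<close> and a sub-Choquet extension of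
  \<open>\<phi>2\<close>; indicators show that no infimum increases.  It remains to see that a one-homogeneous convex
  extension \<open>F\<close> lies below the Choquet extension.  Being sublinear, \<open>F\<close> is bounded on a step function
  approximating \<open>f\<close> by a Riemann sum of the Choquet integral.  The nodes of this sum can be shifted so
  that it does not exceed the integral by more than any given \<open>e > 0\<close>, and lower semicontinuity of \<open>F\<close>
  concludes.
\<close>

section \<open>Riemann sums below the integral\<close>

text \<open>Translating the cells of length \<open>h\<close> back to \<open>{0..h}\<close> stacks
  the pieces of \<open>g\<close> on top of each other. The induction splits off the last
  cell.\<close>

lemma has_integral_shifted_sum:
  fixes g :: "real \<Rightarrow> real"
  assumes "g integrable_on {0..real N * h}" and "0 \<le> h"
  shows "((\<lambda>s. \<Sum>i<N. g (s + real i * h)) has_integral integral {0..real N * h} g) {0..h}"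
  using assms(1)
proof (induction N)
  case 0
  then show ?case by simp
next
  case (Suc N)
  have le: "0 \<le> real N * h" "real N * h \<le> real (Suc N) * h"
    using \<open>0 \<le> h\<close> by (auto intro: mult_right_mono)
  have int1: "g integrable_on {0..real N * h}"
    by (rule integrable_subinterval_real[OF Suc.prems]) (use le in auto)
  have int2: "g integrable_on {real N * h..real (Suc N) * h}"
    by (rule integrable_subinterval_real[OF Suc.prems]) (use le in auto)
  have "((\<lambda>s. g (s + real N * h)) has_integral integral {real N * h..real (Suc N) * h} g) {0..h}"
    using has_integral_shift_cbox[of g _ "real N * h" "real (Suc N) * h" "real N * h"]
      integrable_integral[OF int2] by (simp add: algebra_simps)
  from has_integral_add[OF Suc.IH[OF int1] this] show ?case
    using Henstock_Kurzweil_Integration.integral_combine[OF le Suc.prems] by simp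
qed

text \<open>The average over \<open>s\<close> of the Riemann sums with nodes \<open>s + i h\<close> is the integral, so that some
  choice of \<open>s\<close> makes them at most as large; \<open>s = 0\<close> is a null set and can be avoided.\<close>

lemma shifted_riemann_sum_le_integral:
  fixes g :: "real \<Rightarrow> real"
  assumes g: "g integrable_on {0..real N * h}" and "0 < h" and "0 < e"
  obtains s where "0 < s" "s \<le> h"
    "h * (\<Sum>i<N. g (s + real i * h)) \<le> integral {0..real N * h} g + e"
proof (rule ccontr)
  assume "\<not> thesis"
  with that have big: "h * (\<Sum>i<N. g (s + real i * h)) > integral {0..real N * h} g + e"
    if "0 < s" "s \<le> h" for s
    using that by force
  \<comment> \<open>The negated claim puts the sum above \<open>c\<close> for every positive
    \<open>s\<close>. Resetting its value to \<open>c\<close> at \<open>s = 0\<close> extends the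
    bound to all of \<open>{0..h}\<close>, and integrating it makes the integral plus
    \<open>e\<close> at most the integral.\<close>
  define c where "c = (integral {0..real N * h} g + e) / h"
  let ?G = "\<lambda>s. if s = 0 then c else (\<Sum>i<N. g (s + real i * h))"
  have "(?G has_integral integral {0..real N * h} g) {0..h}"
    by (rule has_integral_spike_finite[OF _ _ has_integral_shifted_sum[OF g], where S = "{0}"])
      (use \<open>0 < h\<close> in auto)
  moreover have "((\<lambda>s. c) has_integral h * c) {0..h}"
    using has_integral_const_real[of c 0 h] \<open>0 < h\<close> by simp
  moreover have "c \<le> ?G s" if "s \<in> {0..h}" for s
    using big[of s] that \<open>0 < h\<close> by (auto simp: c_def field_simps)
  ultimately have "h * c \<le> integral {0..real N * h} g"
    using has_integral_le by blast
  then show False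
    using \<open>0 < h\<close> \<open>0 < e\<close> by (simp add: c_def)
qed

text \<open>The disjunction is the induction invariant: either all nodes so far are at most
  \<open>y\<close>, or the nodes have passed \<open>y\<close> and the sum no longer changes. The
  bound in the first alternative gives the estimate in the second when the next node passes
  \<open>y\<close>.\<close>

lemma layer_count_nonneg:
  fixes y h s :: real
  assumes "0 < h" "0 < s" "s \<le> h" "0 \<le> y"
  shows "(\<Sum>i<N. h * of_bool (s + real i * h \<le> y)) = real N * h \<and> real N * h \<le> y + h \<or>
    \<bar>(\<Sum>i<N. h * of_bool (s + real i * h \<le> y)) - y\<bar> \<le> h \<and> y < s + real N * h"
  using assms by (induction N) (auto simp: algebra_simps)

text \<open>All nodes are positive because \<open>0 < s\<close>, so only one of the two indicators
  can be nonzero, depending on the sign of \<open>y\<close>. The bound on the absolute value of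
  \<open>y\<close> settles the alternative in which every node is counted.\<close>

lemma layer_count_approx:
  fixes y h s :: real
  assumes "0 < h" "0 < s" "s \<le> h" "\<bar>y\<bar> \<le> real N * h"
  shows "\<bar>(\<Sum>i<N. h * (of_bool (s + real i * h \<le> y) - of_bool (y \<le> - (s + real i * h)))) - y\<bar> \<le> h"
proof -
  have pos: "0 < s + real i * h" for i :: nat
    using assms by (simp add: add_pos_nonneg)
  show ?thesis
  proof (cases "0 \<le> y")
    case True
    then have "\<not> y \<le> - (s + real i * h)" for i
      using pos[of i] by linarith
    then have "h * (of_bool (s + real i * h \<le> y) - of_bool (y \<le> - (s + real i * h)))
        = h * of_bool (s + real i * h \<le> y)" for i
      by simp
    then show ?thesis
      using layer_count_nonneg[of h s y N] True assms by (simp only:) auto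
  next
    case False
    then have "\<not> s + real i * h \<le> y" for i
      using pos[of i] by linarith
    then have "h * (of_bool (s + real i * h \<le> y) - of_bool (y \<le> - (s + real i * h)))
        = - (h * of_bool (s + real i * h \<le> - y))" for i
      by auto
    then show ?thesis
      using layer_count_nonneg[of h s "- y" N] False assms by (simp only: sum_negf) auto
  qed
qed

section \<open>Bounded measurable functions and their level sets\<close>

lemma BdI:
  assumes "f \<in> borel_measurable M" "\<And>x. x \<in> space M \<Longrightarrow> \<bar>f x\<bar> \<le> K"
  shows "(\<lambda>x\<in>space M. f x) \<in> Bd M"
proof -
  have "(\<lambda>x\<in>space M. f x) \<in> borel_measurable M"
    using assms(1) by (simp cong: measurable_cong_simp)
  moreover have "bounded ((\<lambda>x\<in>space M. f x) ` space M)"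
    using assms(2) by (auto simp: bounded_iff)
  ultimately show ?thesis
    by (simp add: Bd_def)
qed

lemma Bd_bounded:
  assumes "f \<in> Bd M"
  obtains K where "0 < K" "\<And>x. x \<in> space M \<Longrightarrow> \<bar>f x\<bar> \<le> K"
proof -
  from assms obtain b where b: "\<And>x. x \<in> space M \<Longrightarrow> \<bar>f x\<bar> \<le> b"
    by (auto simp: Bd_def bounded_iff)
  show thesis
    by (rule that[of "max b 1"]) (use b in fastforce)+
qed

lemma Bd_measurable: "f \<in> Bd M \<Longrightarrow> f \<in> borel_measurable M"
  by (simp add: Bd_def)

lemma Bd_restrict: "f \<in> Bd M \<Longrightarrow> (\<lambda>x\<in>space M. f x) = f"
  by (simp add: Bd_def extensional_restrict)

lemma Bd_lincomb:
  assumes "f \<in> Bd M" "g \<in> Bd M"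
  shows "(\<lambda>x\<in>space M. a * f x + b * g x) \<in> Bd M"
proof -
  obtain K L where K: "\<And>x. x \<in> space M \<Longrightarrow> \<bar>f x\<bar> \<le> K" and L: "\<And>x. x \<in> space M \<Longrightarrow> \<bar>g x\<bar> \<le> L"
    using Bd_bounded assms by metis
  show ?thesis
  proof (rule BdI)
    show "(\<lambda>x. a * f x + b * g x) \<in> borel_measurable M"
      using assms[THEN Bd_measurable] by measurable
    fix x assume "x \<in> space M"
    then have "\<bar>a * f x\<bar> \<le> \<bar>a\<bar> * K" "\<bar>b * g x\<bar> \<le> \<bar>b\<bar> * L"
      using K L by (simp_all add: abs_mult mult_left_mono)
    then show "\<bar>a * f x + b * g x\<bar> \<le> \<bar>a\<bar> * K + \<bar>b\<bar> * L"
      by linarith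
  qed
qed

lemma Bd_const: "(\<lambda>x\<in>space M. c) \<in> Bd M"
  by (rule BdI[where K = "\<bar>c\<bar>"]) auto

lemma ind_Bd: "A \<in> sets M \<Longrightarrow> ind M A \<in> Bd M"
  unfolding ind_def by (rule BdI[where K = 1]) (auto simp: indicator_def)

lemma ind_diff_Bd: "A \<in> sets M \<Longrightarrow> A' \<in> sets M \<Longrightarrow> ind_diff M A A' \<in> Bd M"
  unfolding ind_diff_def by (rule BdI[where K = 1]) (auto simp: indicator_def)

lemma upper_set_sets: "f \<in> Bd M \<Longrightarrow> upper_set M f t \<in> sets M"
  using Bd_measurable[of f M] unfolding upper_set_def by measurable

lemma lower_set_sets: "f \<in> Bd M \<Longrightarrow> lower_set M f t \<in> sets M"
  using Bd_measurable[of f M] unfolding lower_set_def by measurable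

lemma level_sets_B2: "f \<in> Bd M \<Longrightarrow> 0 < t \<Longrightarrow> (upper_set M f t, lower_set M f (- t)) \<in> B2 M"
  by (auto simp: B2_def upper_set_sets lower_set_sets) (auto simp: upper_set_def lower_set_def)

lemma inf_fun_le:
  assumes "f \<in> Bd M" "x \<in> space M"
  shows "inf_fun M f \<le> f x"
  unfolding inf_fun_def using assms
  by (intro cINF_lower bounded_imp_bdd_below) (auto simp: Bd_def)

section \<open>Sublinear functionals lie below the layer integral\<close>

lemma one_homogeneousD:
  "one_homogeneous M F \<Longrightarrow> f \<in> Bd M \<Longrightarrow> 0 \<le> c \<Longrightarrow> F (\<lambda>x\<in>space M. c * f x) = c * F f"
  by (simp only: one_homogeneous_def)

text \<open>Convexity at the midpoint, doubled by homogeneity.\<close>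

lemma sublinear_add:
  assumes "one_homogeneous M F" "convex_on_Bd M F" "f \<in> Bd M" "g \<in> Bd M"
  shows "F (\<lambda>x\<in>space M. f x + g x) \<le> F f + F g"
proof -
  let ?m = "\<lambda>x\<in>space M. (1 - 1/2) * f x + (1/2) * g x"
  have "F ?m \<le> (1 - 1/2) * F f + (1/2) * F g"
    using assms(2)[unfolded convex_on_Bd_def, rule_format, OF assms(3,4), of "1/2"] by simp
  moreover have "F (\<lambda>x\<in>space M. 2 * ?m x) = 2 * F ?m"
    by (rule one_homogeneousD[OF assms(1) Bd_lincomb[OF assms(3,4)]]) simp
  moreover have "(\<lambda>x\<in>space M. 2 * ?m x) = (\<lambda>x\<in>space M. f x + g x)"
    by (rule restrict_ext) simp
  ultimately show ?thesis by simp
qed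

lemma one_homogeneous_zero:
  assumes "one_homogeneous M F"
  shows "F (\<lambda>x\<in>space M. 0) = 0"
proof -
  have "F (\<lambda>x\<in>space M. 0 * (\<lambda>x\<in>space M. 0) x) = 0 * F (\<lambda>x\<in>space M. 0)"
    by (rule one_homogeneousD[OF assms Bd_const]) simp
  then show ?thesis by simp
qed

text \<open>Membership in \<open>Bd M\<close> is carried through the induction because homogeneity
  and convexity constrain \<open>F\<close> only there.\<close>

lemma sublinear_sum:
  fixes N :: nat
  assumes "one_homogeneous M F" "convex_on_Bd M F" "\<And>i. i < N \<Longrightarrow> e i \<in> Bd M" "0 \<le> h"
  shows "(\<lambda>x\<in>space M. \<Sum>i<N. h * e i x) \<in> Bd M \<and>
    F (\<lambda>x\<in>space M. \<Sum>i<N. h * e i x) \<le> h * (\<Sum>i<N. F (e i))"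
  using assms(3)
proof (induction N)
  case 0
  then show ?case
    using Bd_const[of 0 M] one_homogeneous_zero[OF assms(1)]
    by (simp only: lessThan_0 sum.empty) simp
next
  case (Suc N)
  let ?S = "\<lambda>x\<in>space M. \<Sum>i<N. h * e i x" and ?T = "\<lambda>x\<in>space M. h * e N x"
  have e: "e N \<in> Bd M"
    using Suc.prems by simp
  have "e i \<in> Bd M" if "i < N" for i
    using Suc.prems that by simp
  from Suc.IH[OF this] have S: "?S \<in> Bd M" "F ?S \<le> h * (\<Sum>i<N. F (e i))"
    by blast+
  have T: "?T \<in> Bd M"
    using Bd_lincomb[OF e e, of h 0] by (simp only: mult_zero_left add_0_right)
  have eq: "(\<lambda>x\<in>space M. \<Sum>i<Suc N. h * e i x) = (\<lambda>x\<in>space M. ?S x + ?T x)"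
    by (rule restrict_ext) simp
  have "F ?T = h * F (e N)"
    by (rule one_homogeneousD[OF assms(1) e assms(4)])
  then have "F (\<lambda>x\<in>space M. ?S x + ?T x) \<le> h * (\<Sum>i<Suc N. F (e i))"
    using sublinear_add[OF assms(1,2) S(1) T] S(2) by (simp only: sum.lessThan_Suc distrib_left)
  moreover have "(\<lambda>x\<in>space M. ?S x + ?T x) \<in> Bd M"
    using Bd_lincomb[OF S(1) T, of 1 1] by (simp only: mult_1)
  ultimately show ?case
    unfolding eq by blast
qed

text \<open>The sum over \<open>i < N\<close> of \<open>h\<close> times the difference of the indicators of \<open>{f \<ge> s + i h}\<close> and
  \<open>{f \<le> - (s + i h)}\<close> is within \<open>h\<close> of \<open>f\<close>.\<close>

lemma sublinear_le_layer_integral: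
  assumes lsc: "lsc_on_Bd M F" and hom: "one_homogeneous M F" and conv: "convex_on_Bd M F"
    and f: "f \<in> Bd M" and "0 < K" and K: "\<And>x. x \<in> space M \<Longrightarrow> \<bar>f x\<bar> \<le> K"
    and int: "(\<lambda>t. F (ind_diff M (upper_set M f t) (lower_set M f (- t)))) integrable_on {0..K}"
  shows "F f \<le> integral {0..K} (\<lambda>t. F (ind_diff M (upper_set M f t) (lower_set M f (- t))))"
proof (cases "space M = {}")
  \<comment> \<open>Here \<open>sup_norm\<close> is a supremum over the empty set, about which
    nothing is known. But \<open>Bd M\<close> then has a single element, the zero function, where
    \<open>F\<close> vanishes by homogeneity.\<close>
  case True
  then have F0: "F u = 0" if "u \<in> Bd M" for u
    using one_homogeneous_zero[OF hom] that by (simp add: Bd_def restrict_def)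
  have "F (ind_diff M (upper_set M f t) (lower_set M f (- t))) = 0" for t
    by (intro F0 ind_diff_Bd upper_set_sets lower_set_sets f)
  with F0[OF f] show ?thesis by simp
next
  case False
  let ?e = "\<lambda>t. ind_diff M (upper_set M f t) (lower_set M f (- t))"
  let ?g = "\<lambda>t. F (?e t)"
  show ?thesis
  proof (rule field_le_epsilon)
    fix e :: real assume "0 < e"
    \<comment> \<open>One half of \<open>e\<close> is spent on lower semicontinuity, the other on
      the Riemann sum.\<close>
    obtain \<delta> where "0 < \<delta>"
      and \<delta>: "\<And>g. g \<in> Bd M \<Longrightarrow> sup_norm M (\<lambda>x. g x - f x) < \<delta> \<Longrightarrow> F f - e/2 < F g"
      using lsc[unfolded lsc_on_Bd_def, rule_format, OF f, of "F f - e/2"] \<open>0 < e\<close> by auto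
    \<comment> \<open>A large \<open>N\<close> makes the step \<open>h = K / N\<close> smaller than
      \<delta>, while \<open>N\<close> steps still cover \<open>{0..K}\<close> exactly.\<close>
    obtain N :: nat where N: "K / \<delta> < real N"
      using reals_Archimedean2 by blast
    have "0 < K / \<delta>"
      using \<open>0 < K\<close> \<open>0 < \<delta>\<close> by simp
    with N have "0 < real N" by linarith
    define h where "h = K / real N"
    have h: "0 < h" "h < \<delta>" "real N * h = K"
      using \<open>0 < K\<close> \<open>0 < \<delta>\<close> \<open>0 < real N\<close> N by (simp_all add: h_def field_simps)
    obtain s where s: "0 < s" "s \<le> h"
      and le: "h * (\<Sum>i<N. ?g (s + real i * h)) \<le> integral {0..K} ?g + e/2"
      using shifted_riemann_sum_le_integral[of ?g N h "e/2"] int h \<open>0 < e\<close> by auto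
    define u where "u = (\<lambda>x\<in>space M. \<Sum>i<N. h * ?e (s + real i * h) x)"
    have "?e (s + real i * h) \<in> Bd M" for i
      by (intro ind_diff_Bd upper_set_sets lower_set_sets f)
    from sublinear_sum[where e = "\<lambda>i. ?e (s + real i * h)" and N = N,
        OF hom conv this less_imp_le[OF h(1)]]
    have u: "u \<in> Bd M" "F u \<le> h * (\<Sum>i<N. ?g (s + real i * h))"
      unfolding u_def by blast+
    have "\<bar>u x - f x\<bar> \<le> h" if x: "x \<in> space M" for x
    proof -
      have "u x = (\<Sum>i<N. h * (of_bool (s + real i * h \<le> f x) - of_bool (f x \<le> - (s + real i * h))))"
        using x by (auto simp: u_def ind_diff_def upper_set_def lower_set_def indicator_def
            intro!: sum.cong)
      then show ?thesis
        using layer_count_approx[OF h(1) s, of "f x" N] K[OF x] h(3) by simp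
    qed
    then have "sup_norm M (\<lambda>x. u x - f x) \<le> h"
      unfolding sup_norm_def using False by (intro cSUP_least) auto
    with \<delta>[OF u(1)] h(2) have "F f - e/2 < F u" by simp
    with u(2) le show "F f \<le> integral {0..K} ?g + e" by simp
  qed
qed

section \<open>Choquet extensions\<close>

lemma set_integrable_const_atLeast_imp_zero:
  fixes a c :: real
  assumes "set_integrable lebesgue {a..} (\<lambda>t. c)"
  shows "c = 0"
proof (rule ccontr)
  assume "c \<noteq> 0"
  \<comment> \<open>The integral of the constant over an interval of this length exceeds the
    integral over the whole half-line by at least the absolute value of \<open>c\<close>.\<close>
  define n where "n = \<bar>integral {a..} (\<lambda>t. \<bar>c\<bar>)\<bar> / \<bar>c\<bar> + 1"
  have int: "(\<lambda>t. \<bar>c\<bar>) integrable_on {a..}"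
    using set_lebesgue_integral_eq_integral(1)[OF set_integrable_abs[OF assms]] .
  have "0 \<le> n" by (simp add: n_def)
  have "integral {a..a + n} (\<lambda>t. \<bar>c\<bar>) \<le> integral {a..} (\<lambda>t. \<bar>c\<bar>)"
    by (rule integral_subset_le) (auto simp: int)
  then have "\<bar>c\<bar> * n \<le> integral {a..} (\<lambda>t. \<bar>c\<bar>)"
    using \<open>0 \<le> n\<close> by (simp add: mult.commute)
  moreover have "\<bar>c\<bar> * n = \<bar>integral {a..} (\<lambda>t. \<bar>c\<bar>)\<bar> + \<bar>c\<bar>"
    using \<open>c \<noteq> 0\<close> by (simp add: n_def field_simps)
  ultimately show False
    using \<open>c \<noteq> 0\<close> by linarith
qed

text \<open>Far enough to the right, every level set of the zero function is empty, and a constant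
  is integrable on a half-line only if it is zero.\<close>

lemma Psi_empty:
  assumes "\<phi> \<in> Psi M"
  shows "\<phi> {} = 0"
proof -
  \<comment> \<open>If \<open>space M\<close> is empty, \<open>inf_fun\<close> is an unspecified
    real. The maximum with 1 keeps the half-line inside the domain of integrability and strictly
    above the value 0 in every case.\<close>
  let ?f = "\<lambda>x\<in>space M. 0 :: real" and ?b = "max 1 (inf_fun M (\<lambda>x\<in>space M. 0))"
  have "set_integrable lebesgue {inf_fun M ?f..} (\<lambda>t. \<phi> (upper_set M ?f t))"
    using assms Bd_const[of 0 M] by (simp add: Psi_def)
  then have "set_integrable lebesgue {?b..} (\<lambda>t. \<phi> (upper_set M ?f t))"
    by (rule set_integrable_subset) auto
  also have "?this \<longleftrightarrow> set_integrable lebesgue {?b..} (\<lambda>t. \<phi> {})"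
    by (rule set_integrable_cong) (auto simp: upper_set_def intro!: arg_cong[of _ _ \<phi>])
  finally show ?thesis
    by (rule set_integrable_const_atLeast_imp_zero)
qed

lemma Psi2_empty:
  assumes "\<psi> \<in> Psi2 M"
  shows "\<psi> ({}, {}) = 0"
proof -
  let ?f = "\<lambda>x\<in>space M. 0 :: real"
  have "set_integrable lebesgue {0<..} (\<lambda>t. \<psi> (upper_set M ?f t, lower_set M ?f (- t)))"
    using assms Bd_const[of 0 M] by (simp add: Psi2_def)
  then have "set_integrable lebesgue {1..} (\<lambda>t. \<psi> (upper_set M ?f t, lower_set M ?f (- t)))"
    by (rule set_integrable_subset) auto
  also have "?this \<longleftrightarrow> set_integrable lebesgue {1::real..} (\<lambda>t. \<psi> ({}, {}))"
    by (rule set_integrable_cong) (auto simp: upper_set_def lower_set_def intro!: arg_cong[of _ _ \<psi>])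
  finally show ?thesis
    by (rule set_integrable_const_atLeast_imp_zero)
qed

text \<open>Level sets beyond the upper bound of \<open>f\<close> are empty and contribute
  \<open>\<phi> {} = 0\<close>, so the half-line can be cut off. The shift by
  \<open>inf_fun M f\<close> makes the interval start at 0, as it does for the layers of
  \<open>f\<close> minus its infimum.\<close>

lemma choquet_compact:
  assumes \<phi>: "\<phi> \<in> Psi M" and f: "f \<in> Bd M" and "0 \<le> K"
    and K: "\<And>x. x \<in> space M \<Longrightarrow> f x \<le> K + inf_fun M f"
  shows "(\<lambda>t. \<phi> (upper_set M f (t + inf_fun M f))) integrable_on {0..K}" (is ?int)
    and "choquet M \<phi> f =
      integral {0..K} (\<lambda>t. \<phi> (upper_set M f (t + inf_fun M f))) + \<phi> (space M) * inf_fun M f" (is ?eq)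
proof -
  let ?m = "inf_fun M f" and ?g = "\<lambda>t. \<phi> (upper_set M f t)"
  have si: "set_integrable lebesgue {?m..} ?g"
    using \<phi> f by (simp add: Psi_def)
  have 0: "?g t = 0" if "K + ?m < t" for t
  proof -
    have "upper_set M f t = {}"
      using K that by (fastforce simp: upper_set_def)
    then show ?thesis
      using Psi_empty[OF \<phi>] by simp
  qed
  have "?g integrable_on {?m..K + ?m}"
    by (rule integrable_spike_set[OF set_lebesgue_integral_eq_integral(1)[OF si]];
        rule negligible_subset[OF negligible_empty]) (use 0 in force)+
  from has_integral_shift_cbox[of ?g "integral {?m..K + ?m} ?g" ?m "K + ?m" ?m]
    integrable_integral[OF this]
  have hi: "((\<lambda>t. ?g (t + ?m)) has_integral integral {?m..K + ?m} ?g) {0..K}"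
    by simp
  then show ?int by blast
  have "(LINT t:{?m..}|lebesgue. ?g t) = integral {?m..} ?g"
    using set_lebesgue_integral_eq_integral(2)[OF si] .
  also have "\<dots> = integral {?m..K + ?m} ?g"
    by (rule integral_spike_set; rule negligible_subset[OF negligible_empty]) (use 0 in force)+
  finally show ?eq
    using integral_unique[OF hi] by (simp add: choquet_def)
qed

lemma choquet2_compact:
  assumes \<psi>: "\<psi> \<in> Psi2 M" and f: "f \<in> Bd M" and K: "\<And>x. x \<in> space M \<Longrightarrow> \<bar>f x\<bar> \<le> K"
  shows "(\<lambda>t. \<psi> (upper_set M f t, lower_set M f (- t))) integrable_on {0..K}" (is ?int)
    and "choquet2 M \<psi> f = integral {0..K} (\<lambda>t. \<psi> (upper_set M f t, lower_set M f (- t)))" (is ?eq)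
proof -
  let ?g = "\<lambda>t. \<psi> (upper_set M f t, lower_set M f (- t))"
  have si: "set_integrable lebesgue {0<..} ?g"
    using \<psi> f by (simp add: Psi2_def)
  have 0: "?g t = 0" if "K < t" for t
  proof -
    have "upper_set M f t = {}" "lower_set M f (- t) = {}"
      using K that by (fastforce simp: upper_set_def lower_set_def)+
    then show ?thesis
      using Psi2_empty[OF \<psi>] by simp
  qed
  have neg: "negligible {t \<in> {0<..} - {0..K}. ?g t \<noteq> 0}"
    by (rule negligible_subset[OF negligible_empty]) (use 0 in force)
  \<comment> \<open>At 0 the two level sets may overlap, namely where \<open>f\<close> vanishes, so
    the value of \<psi> there is unconstrained; a single point is negligible.\<close>
  have neg': "negligible {t \<in> {0..K} - {0<..}. ?g t \<noteq> 0}"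
    by (rule negligible_subset[of "{0}"]) auto
  show ?int
    by (rule integrable_spike_set[OF set_lebesgue_integral_eq_integral(1)[OF si] neg neg'])
  show ?eq
    unfolding choquet2_def set_lebesgue_integral_eq_integral(2)[OF si]
    by (rule integral_spike_set[OF neg neg'])
qed

lemma choquet_ind:
  assumes \<phi>: "\<phi> \<in> Psi M" "\<phi> (space M) = 0" and A: "A \<in> sets M"
  shows "choquet M \<phi> (ind M A) = \<phi> A"
proof (cases "A = space M")
  \<comment> \<open>With \<open>K = 0\<close> the integral is over a point. The remaining term
    vanishes by \<open>\<phi> (space M) = 0\<close>, even if \<open>space M\<close> is empty and the
    infimum unspecified.\<close>
  case True
  have "ind M A x \<le> 0 + inf_fun M (ind M A)" if "x \<in> space M" for x
    using that True by (auto simp: ind_def inf_fun_def intro!: cINF_greatest)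
  from choquet_compact(2)[OF \<phi>(1) ind_Bd[OF A] order_refl this] True \<phi>(2) show ?thesis
    by simp
next
  case False
  with sets.sets_into_space[OF A] obtain x where x: "x \<in> space M" "x \<notin> A"
    by blast
  have "inf_fun M (ind M A) \<le> 0"
    using inf_fun_le[OF ind_Bd[OF A] x(1)] x by (simp add: ind_def)
  moreover have "0 \<le> inf_fun M (ind M A)"
    unfolding inf_fun_def using x by (intro cINF_greatest) (auto simp: ind_def)
  ultimately have inf: "inf_fun M (ind M A) = 0" by simp
  have "choquet M \<phi> (ind M A) = integral {0..1} (\<lambda>t. \<phi> (upper_set M (ind M A) t))"
    using choquet_compact(2)[OF \<phi>(1) ind_Bd[OF A], of 1] inf
    by (simp add: ind_def indicator_def)
  also have "\<dots> = integral {0..1} (\<lambda>t::real. \<phi> A)"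
  proof (rule integral_spike[of "{0}"])
    \<comment> \<open>At \<open>t = 0\<close> the level set is the whole space instead of
      \<open>A\<close>, hence the exceptional point.\<close>
    fix t :: real assume "t \<in> {0..1} - {0}"
    then have "upper_set M (ind M A) t = A"
      using sets.sets_into_space[OF A] by (auto simp: upper_set_def ind_def indicator_def)
    then show "\<phi> A = \<phi> (upper_set M (ind M A) t)" by simp
  qed simp
  finally show ?thesis by simp
qed

lemma choquet2_ind_diff:
  assumes \<psi>: "\<psi> \<in> Psi2 M" and A: "(A, A') \<in> B2 M"
  shows "choquet2 M \<psi> (ind_diff M A A') = \<psi> (A, A')"
proof -
  let ?f = "ind_diff M A A'"
  have AA: "A \<in> sets M" "A' \<in> sets M" "A \<inter> A' = {}"
    using A by (auto simp: B2_def)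
  have "choquet2 M \<psi> ?f = integral {0..1} (\<lambda>t. \<psi> (upper_set M ?f t, lower_set M ?f (- t)))"
    by (rule choquet2_compact(2)[OF \<psi> ind_diff_Bd[OF AA(1,2)]])
      (auto simp: ind_diff_def indicator_def)
  also have "\<dots> = integral {0..1} (\<lambda>t::real. \<psi> (A, A'))"
  proof (rule integral_spike[of "{0}"])
    fix t :: real assume "t \<in> {0..1} - {0}"
    then have "upper_set M ?f t = A" "lower_set M ?f (- t) = A'"
      using AA(3) sets.sets_into_space[OF AA(1)] sets.sets_into_space[OF AA(2)]
      by (auto simp: upper_set_def lower_set_def ind_diff_def indicator_def split: if_splits)
    then show "\<psi> (A, A') = \<psi> (upper_set M ?f t, lower_set M ?f (- t))" by simp
  qed simp
  finally show ?thesis by simp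
qed

text \<open>The terms containing the infimum of \<open>f\<close> could have either sign; they drop
  out because both set functions vanish on \<open>space M\<close>.\<close>

lemma choquet_scaled_mono:
  assumes \<phi>: "\<phi>1 \<in> Psi M" "\<phi>2 \<in> Psi M" "\<phi>1 (space M) = 0" "\<phi>2 (space M) = 0" and f: "f \<in> Bd M"
    and le: "\<And>A. A \<in> sets M \<Longrightarrow> r * \<phi>2 A \<le> \<phi>1 A"
  shows "r * choquet M \<phi>2 f \<le> choquet M \<phi>1 f"
proof -
  have "r * (LINT t:{inf_fun M f..}|lebesgue. \<phi>2 (upper_set M f t))
      \<le> (LINT t:{inf_fun M f..}|lebesgue. \<phi>1 (upper_set M f t))"
    unfolding set_integral_mult_right[symmetric]
    using \<phi>(1,2) f le[OF upper_set_sets[OF f]]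
    by (intro set_integral_mono set_integrable_mult_right) (auto simp: Psi_def)
  then show ?thesis
    by (simp add: choquet_def \<phi>)
qed

lemma choquet2_scaled_mono:
  assumes \<psi>: "\<psi>1 \<in> Psi2 M" "\<psi>2 \<in> Psi2 M" and f: "f \<in> Bd M"
    and le: "\<And>p. p \<in> B2 M \<Longrightarrow> r * \<psi>2 p \<le> \<psi>1 p"
  shows "r * choquet2 M \<psi>2 f \<le> choquet2 M \<psi>1 f"
  unfolding choquet2_def set_integral_mult_right[symmetric]
  using \<psi> f le[OF level_sets_B2[OF f]]
  by (intro set_integral_mono set_integrable_mult_right) (auto simp: Psi2_def)

text \<open>For positive \<open>t\<close> the level sets form a pair in \<open>B2 M\<close>, where
  \<open>F\<close> agrees with \<psi>, so the layer integral of \<open>F\<close> is the Choquet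
  integral. The possibly overlapping pair at \<open>t = 0\<close> is ignored as a null set.\<close>

lemma one_homogeneous_convex_ext2_le_choquet2:
  assumes \<psi>: "\<psi> \<in> Psi2 M" and F: "one_homogeneous_convex_ext2 M \<psi> F" and f: "f \<in> Bd M"
  shows "F f \<le> choquet2 M \<psi> f"
proof -
  obtain K where K: "0 < K" "\<And>x. x \<in> space M \<Longrightarrow> \<bar>f x\<bar> \<le> K"
    using Bd_bounded[OF f] by blast
  have eq: "F (ind_diff M (upper_set M f t) (lower_set M f (- t)))
      = \<psi> (upper_set M f t, lower_set M f (- t))" if "t \<in> {0..K} - {0}" for t
    using F level_sets_B2[OF f, of t] that
    by (auto simp: one_homogeneous_convex_ext2_def extends2_def)
  note compact = choquet2_compact[OF \<psi> f K(2)]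
  have "F f \<le> integral {0..K} (\<lambda>t. F (ind_diff M (upper_set M f t) (lower_set M f (- t))))"
    using F sublinear_le_layer_integral[OF _ _ _ f K] eq
      integrable_spike_finite[of "{0}", OF _ eq compact(1)]
    by (auto simp: one_homogeneous_convex_ext2_def)
  also have "\<dots> = integral {0..K} (\<lambda>t. \<psi> (upper_set M f t, lower_set M f (- t)))"
    by (rule integral_spike[of "{0}"]) (auto simp: eq)
  also have "\<dots> = choquet2 M \<psi> f"
    using compact(2) by simp
  finally show ?thesis .
qed

text \<open>Evenness is what makes constants negligible: it forces \<open>F (- 1) = F 1 = \<phi> (space M) = 0\<close>.\<close>

lemma one_homogeneous_convex_ext_const:
  assumes F: "one_homogeneous_convex_ext M \<phi> F" and "\<phi> (space M) = 0"
  shows "F (\<lambda>x\<in>space M. c) = 0"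
proof -
  have one: "ind M (space M) = (\<lambda>x\<in>space M. 1)"
    by (auto simp: ind_def restrict_def)
  have "F (\<lambda>x\<in>space M. 1) = \<phi> (space M)"
    using F sets.top[of M] unfolding one_homogeneous_convex_ext_def extends_def one[symmetric] by blast
  moreover have "F (\<lambda>x\<in>space M. \<bar>c\<bar> * (\<lambda>x\<in>space M. 1) x) = \<bar>c\<bar> * F (\<lambda>x\<in>space M. 1)"
    using F Bd_const by (intro one_homogeneousD) (auto simp only: one_homogeneous_convex_ext_def abs_ge_zero)
  ultimately have abs: "F (\<lambda>x\<in>space M. \<bar>c\<bar>) = 0"
    using assms(2) by (simp cong: restrict_cong)
  have "F (\<lambda>x\<in>space M. - (\<lambda>x\<in>space M. \<bar>c\<bar>) x) = F (\<lambda>x\<in>space M. \<bar>c\<bar>)"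
    using F Bd_const[of "\<bar>c\<bar>" M] by (simp only: one_homogeneous_convex_ext_def even_on_Bd_def)
  with abs show ?thesis
    by (cases "0 \<le> c") (simp_all cong: restrict_cong)
qed

lemma one_homogeneous_convex_ext_le_choquet:
  assumes \<phi>: "\<phi> \<in> Psi M" "\<phi> (space M) = 0" and F: "one_homogeneous_convex_ext M \<phi> F"
    and f: "f \<in> Bd M"
  shows "F f \<le> choquet M \<phi> f"
proof -
  let ?m = "inf_fun M f"
  have hom: "lsc_on_Bd M F" "one_homogeneous M F" "convex_on_Bd M F"
    and ext: "\<And>A. A \<in> sets M \<Longrightarrow> F (ind M A) = \<phi> A"
    using F by (auto simp: one_homogeneous_convex_ext_def extends_def)
  \<comment> \<open>Subtracting the infimum gives a nonnegative function. Its lower level sets at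
    \<open>- t\<close> are empty for positive \<open>t\<close>, which reduces the layers of pairs to
    indicators of single sets.\<close>
  define f0 where "f0 = (\<lambda>x\<in>space M. f x - ?m)"
  have f0: "f0 \<in> Bd M"
    using Bd_lincomb[OF f Bd_const[of ?m M], of 1 "-1"] by (simp add: f0_def cong: restrict_cong)
  obtain K where K: "0 < K" "\<And>x. x \<in> space M \<Longrightarrow> \<bar>f0 x\<bar> \<le> K"
    using Bd_bounded[OF f0] by blast
  have eq: "F (ind_diff M (upper_set M f0 t) (lower_set M f0 (- t))) = \<phi> (upper_set M f (t + ?m))"
    if "t \<in> {0..K} - {0}" for t
  proof -
    have up: "upper_set M f0 t = upper_set M f (t + ?m)"
      by (auto simp: upper_set_def f0_def)
    have lo: "lower_set M f0 (- t) = {}"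
      using inf_fun_le[OF f] that by (force simp: lower_set_def f0_def)
    have "ind_diff M (upper_set M f0 t) (lower_set M f0 (- t)) = ind M (upper_set M f (t + ?m))"
      unfolding up lo by (auto simp: ind_diff_def ind_def restrict_def)
    with ext upper_set_sets[OF f] show ?thesis by simp
  qed
  have "f x \<le> K + ?m" if "x \<in> space M" for x
    using K(2)[OF that] that by (simp add: f0_def)
  note compact = choquet_compact[OF \<phi>(1) f less_imp_le[OF K(1)] this]
  have "f = (\<lambda>x\<in>space M. f0 x + (\<lambda>x\<in>space M. ?m) x)"
    using Bd_restrict[OF f] by (simp add: f0_def cong: restrict_cong)
  \<comment> \<open>Subadditivity returns from \<open>f0\<close> to \<open>f\<close>, and the
    constant that is added back costs nothing.\<close>
  then have "F f \<le> F f0 + F (\<lambda>x\<in>space M. ?m)"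
    using sublinear_add[OF hom(2,3) f0 Bd_const[of ?m M]] by simp
  also have "\<dots> = F f0"
    using one_homogeneous_convex_ext_const[OF F \<phi>(2)] by simp
  also have "\<dots> \<le> integral {0..K} (\<lambda>t. F (ind_diff M (upper_set M f0 t) (lower_set M f0 (- t))))"
    by (rule sublinear_le_layer_integral[OF hom f0 K];
        (rule integrable_spike_finite[of "{0}", OF _ eq compact(1)])?) auto
  also have "\<dots> = integral {0..K} (\<lambda>t. \<phi> (upper_set M f (t + ?m)))"
    by (rule integral_spike[of "{0}"]) (auto simp: eq)
  also have "\<dots> = choquet M \<phi> f"
    using compact(2) \<phi>(2) by simp
  finally show ?thesis .
qed

section \<open>Comparison of the infima\<close>

text \<open>This abstracts all four comparisons: \<open>S\<close> stands for the sets or pairs,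
  \<open>e\<close> for the passage to indicators, and \<open>mono\<close> for the transfer of a
  scaled inequality from sets to functions. Extended reals give an empty infimum the value
  infinity.\<close>

lemma INF_ratio_extension:
  fixes a1 a2 :: "'s \<Rightarrow> real" and D1 D2 :: "'f \<Rightarrow> real"
  assumes nonneg: "\<And>A. A \<in> S \<Longrightarrow> 0 \<le> a1 A" "\<And>A. A \<in> S \<Longrightarrow> 0 \<le> a2 A"
    and ext: "\<And>A. A \<in> S \<Longrightarrow> e A \<in> X" "\<And>A. A \<in> S \<Longrightarrow> D1 (e A) = a1 A"
      "\<And>A. A \<in> S \<Longrightarrow> D2 (e A) = a2 A"
    and mono: "\<And>r f. \<lbrakk>0 \<le> r; \<And>A. A \<in> S \<Longrightarrow> r * a2 A \<le> a1 A; f \<in> X\<rbrakk> \<Longrightarrow> r * D2 f \<le> D1 f"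
  shows "(INF A\<in>{A \<in> S. 0 < a2 A}. ereal (a1 A / a2 A)) =
    (INF f\<in>{f \<in> X. 0 < D2 f}. ereal (D1 f / D2 f))" (is "?L = ?R")
proof (rule antisym)
  show "?R \<le> ?L"
  proof (rule INF_mono)
    fix A assume "A \<in> {A \<in> S. 0 < a2 A}"
    then show "\<exists>f\<in>{f \<in> X. 0 < D2 f}. ereal (D1 f / D2 f) \<le> ereal (a1 A / a2 A)"
      using ext by (intro bexI[of _ "e A"]) auto
  qed
  show "?L \<le> ?R"
  proof (rule INF_greatest, rule ccontr)
    fix f assume "f \<in> {f \<in> X. 0 < D2 f}"
    then have f: "f \<in> X" "0 < D2 f" by auto
    assume "\<not> ?L \<le> ereal (D1 f / D2 f)"
    then have "ereal (D1 f / D2 f) < ?L" by (rule not_le_imp_less)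
    \<comment> \<open>A real \<open>r\<close> is available even if the infimum over \<open>S\<close>
      is infinite. Being below that infimum it satisfies the premise of \<open>mono\<close>, whose
      conclusion contradicts \<open>r\<close> being above the ratio at \<open>f\<close>.\<close>
    from ereal_dense2[OF this] obtain r where r: "ereal (D1 f / D2 f) < ereal r" "ereal r < ?L"
      by blast
    \<comment> \<open>Nonnegativity of \<open>a1\<close> is the premise of \<open>mono\<close> for
      the factor 0; this makes the ratio, and hence \<open>r\<close>, nonnegative.\<close>
    have "0 \<le> D1 f"
      using mono[of 0 f] nonneg f by simp
    then have "0 \<le> D1 f / D2 f"
      using f by simp
    with r(1) have "0 \<le> r" by simp
    moreover have "r * a2 A \<le> a1 A" if "A \<in> S" for A
    proof (cases "0 < a2 A")
      case True
      then have "?L \<le> ereal (a1 A / a2 A)"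
        using that by (intro INF_lower) auto
      from less_le_trans[OF r(2) this] have "r < a1 A / a2 A"
        by simp
      with True show ?thesis
        by (simp add: field_simps)
    next
      case False
      then have "a2 A = 0"
        using nonneg(2)[OF that] by simp
      then show ?thesis
        using nonneg(1)[OF that] by simp
    qed
    ultimately have "r * D2 f \<le> D1 f"
      using mono f by blast
    with r(1) f show False
      by (simp add: field_simps)
  qed
qed

theorem theorem3p2:
  fixes M :: "'a measure"
    and \<phi>1 \<phi>2 :: "'a set \<Rightarrow> real"
    and \<psi>1 \<psi>2 :: "'a set \<times> 'a set \<Rightarrow> real"
    and \<phi>t1 \<phi>t2 \<psi>t1 \<psi>t2 :: "('a \<Rightarrow> real) \<Rightarrow> real"
  shows "(\<phi>1 \<in> Psi M \<and> \<phi>2 \<in> Psi M \<and>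
      (\<forall>A\<in>sets M. 0 \<le> \<phi>1 A) \<and> (\<forall>A\<in>sets M. 0 \<le> \<phi>2 A) \<and>
      \<phi>1 (space M) = 0 \<and> \<phi>2 (space M) = 0 \<and>
      super_choquet_ext M \<phi>1 \<phi>t1 \<and>
      (sub_choquet_ext M \<phi>2 \<phi>t2 \<or>
        (submodular M \<phi>2 \<and> one_homogeneous_convex_ext M \<phi>2 \<phi>t2))
    \<longrightarrow>
      (INF A\<in>{A \<in> sets M. \<phi>2 A > 0}. ereal (\<phi>1 A / \<phi>2 A)) =
        (INF f\<in>{f \<in> Bd M. choquet M \<phi>2 f > 0}. ereal (choquet M \<phi>1 f / choquet M \<phi>2 f)) \<and>
      (INF f\<in>{f \<in> Bd M. choquet M \<phi>2 f > 0}. ereal (choquet M \<phi>1 f / choquet M \<phi>2 f)) =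
        (INF f\<in>{f \<in> Bd M. \<phi>t2 f > 0}. ereal (\<phi>t1 f / \<phi>t2 f)))
    \<and>
    (\<psi>1 \<in> Psi2 M \<and> \<psi>2 \<in> Psi2 M \<and>
      (\<forall>p\<in>B2 M. 0 \<le> \<psi>1 p) \<and> (\<forall>p\<in>B2 M. 0 \<le> \<psi>2 p) \<and>
      super_choquet_ext2 M \<psi>1 \<psi>t1 \<and>
      (sub_choquet_ext2 M \<psi>2 \<psi>t2 \<or>
        (bisubmodular M \<psi>2 \<and> one_homogeneous_convex_ext2 M \<psi>2 \<psi>t2))
    \<longrightarrow>
      (INF p\<in>{p \<in> B2 M. \<psi>2 p > 0}. ereal (\<psi>1 p / \<psi>2 p)) =
        (INF f\<in>{f \<in> Bd M. choquet2 M \<psi>2 f > 0}. ereal (choquet2 M \<psi>1 f / choquet2 M \<psi>2 f)) \<and>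
      (INF f\<in>{f \<in> Bd M. choquet2 M \<psi>2 f > 0}. ereal (choquet2 M \<psi>1 f / choquet2 M \<psi>2 f)) =
        (INF f\<in>{f \<in> Bd M. \<psi>t2 f > 0}. ereal (\<psi>t1 f / \<psi>t2 f)))"
proof (intro conjI[of "_ \<longrightarrow> _"] impI; elim conjE)
  assume \<phi>: "\<phi>1 \<in> Psi M" "\<phi>2 \<in> Psi M" "\<phi>1 (space M) = 0" "\<phi>2 (space M) = 0"
    and nonneg: "\<forall>A\<in>sets M. 0 \<le> \<phi>1 A" "\<forall>A\<in>sets M. 0 \<le> \<phi>2 A"
    and sup: "super_choquet_ext M \<phi>1 \<phi>t1"
    and sub: "sub_choquet_ext M \<phi>2 \<phi>t2 \<or>
      submodular M \<phi>2 \<and> one_homogeneous_convex_ext M \<phi>2 \<phi>t2"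
  have le1: "choquet M \<phi>1 f \<le> \<phi>t1 f" if "f \<in> Bd M" for f
    using sup that by (simp add: super_choquet_ext_def)
  have le2: "\<phi>t2 f \<le> choquet M \<phi>2 f" if "f \<in> Bd M" for f
    using sub that one_homogeneous_convex_ext_le_choquet[OF \<phi>(2,4)]
    by (auto simp: sub_choquet_ext_def)
  have ext: "\<phi>t1 (ind M A) = \<phi>1 A" "\<phi>t2 (ind M A) = \<phi>2 A" if "A \<in> sets M" for A
    using sup sub that
    by (auto simp: super_choquet_ext_def sub_choquet_ext_def one_homogeneous_convex_ext_def extends_def)
  \<comment> \<open>Each infimum over functions is compared with the one over sets; the equality
    between the two then follows.\<close>
  have "(INF A\<in>{A \<in> sets M. \<phi>2 A > 0}. ereal (\<phi>1 A / \<phi>2 A)) =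
      (INF f\<in>{f \<in> Bd M. choquet M \<phi>2 f > 0}. ereal (choquet M \<phi>1 f / choquet M \<phi>2 f))"
    by (rule INF_ratio_extension[where S = "sets M" and X = "Bd M" and e = "ind M"])
      (use nonneg in \<open>blast intro: ind_Bd choquet_ind \<phi> choquet_scaled_mono[OF \<phi>]\<close>)+
  moreover have "(INF A\<in>{A \<in> sets M. \<phi>2 A > 0}. ereal (\<phi>1 A / \<phi>2 A)) =
      (INF f\<in>{f \<in> Bd M. \<phi>t2 f > 0}. ereal (\<phi>t1 f / \<phi>t2 f))"
  proof (rule INF_ratio_extension[where S = "sets M" and X = "Bd M" and e = "ind M"])
    \<comment> \<open>The Choquet extensions link the two functionals; the factor \<open>r\<close>
      must be nonnegative to preserve the upper bound on \<open>\<phi>t2\<close>.\<close>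
    fix r f assume "0 \<le> r" "\<And>A. A \<in> sets M \<Longrightarrow> r * \<phi>2 A \<le> \<phi>1 A" "f \<in> Bd M"
    then have "r * \<phi>t2 f \<le> r * choquet M \<phi>2 f" "r * choquet M \<phi>2 f \<le> choquet M \<phi>1 f"
      "choquet M \<phi>1 f \<le> \<phi>t1 f"
      by (auto intro: mult_left_mono le1 le2 choquet_scaled_mono[OF \<phi>])
    then show "r * \<phi>t2 f \<le> \<phi>t1 f" by linarith
  qed (use nonneg in \<open>blast intro: ind_Bd ext\<close>)+
  ultimately show "(INF A\<in>{A \<in> sets M. \<phi>2 A > 0}. ereal (\<phi>1 A / \<phi>2 A)) =
        (INF f\<in>{f \<in> Bd M. choquet M \<phi>2 f > 0}. ereal (choquet M \<phi>1 f / choquet M \<phi>2 f)) \<and>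
      (INF f\<in>{f \<in> Bd M. choquet M \<phi>2 f > 0}. ereal (choquet M \<phi>1 f / choquet M \<phi>2 f)) =
        (INF f\<in>{f \<in> Bd M. \<phi>t2 f > 0}. ereal (\<phi>t1 f / \<phi>t2 f))"
    by simp
next
  assume \<psi>: "\<psi>1 \<in> Psi2 M" "\<psi>2 \<in> Psi2 M"
    and nonneg: "\<forall>p\<in>B2 M. 0 \<le> \<psi>1 p" "\<forall>p\<in>B2 M. 0 \<le> \<psi>2 p"
    and sup: "super_choquet_ext2 M \<psi>1 \<psi>t1"
    and sub: "sub_choquet_ext2 M \<psi>2 \<psi>t2 \<or>
      bisubmodular M \<psi>2 \<and> one_homogeneous_convex_ext2 M \<psi>2 \<psi>t2"
  let ?e = "\<lambda>(A, A'). ind_diff M A A'"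
  have le1: "choquet2 M \<psi>1 f \<le> \<psi>t1 f" if "f \<in> Bd M" for f
    using sup that by (simp add: super_choquet_ext2_def)
  have le2: "\<psi>t2 f \<le> choquet2 M \<psi>2 f" if "f \<in> Bd M" for f
    using sub that one_homogeneous_convex_ext2_le_choquet2[OF \<psi>(2)]
    by (auto simp: sub_choquet_ext2_def)
  have ext: "\<psi>t1 (?e p) = \<psi>1 p" "\<psi>t2 (?e p) = \<psi>2 p" if "p \<in> B2 M" for p
    using sup sub that
    by (auto simp: super_choquet_ext2_def sub_choquet_ext2_def one_homogeneous_convex_ext2_def
        extends2_def)
  have Bd: "?e p \<in> Bd M" if "p \<in> B2 M" for p
    using that by (auto simp: B2_def ind_diff_Bd)
  have choquet2_ext: "choquet2 M \<psi> (?e p) = \<psi> p" if "\<psi> \<in> Psi2 M" "p \<in> B2 M" for \<psi> p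
    using that choquet2_ind_diff by (cases p) simp
  have "(INF p\<in>{p \<in> B2 M. \<psi>2 p > 0}. ereal (\<psi>1 p / \<psi>2 p)) =
      (INF f\<in>{f \<in> Bd M. choquet2 M \<psi>2 f > 0}. ereal (choquet2 M \<psi>1 f / choquet2 M \<psi>2 f))"
    by (rule INF_ratio_extension[where S = "B2 M" and X = "Bd M" and e = ?e])
      (use nonneg in \<open>blast intro: Bd choquet2_ext \<psi> choquet2_scaled_mono[OF \<psi>]\<close>)+
  moreover have "(INF p\<in>{p \<in> B2 M. \<psi>2 p > 0}. ereal (\<psi>1 p / \<psi>2 p)) =
      (INF f\<in>{f \<in> Bd M. \<psi>t2 f > 0}. ereal (\<psi>t1 f / \<psi>t2 f))"
  proof (rule INF_ratio_extension[where S = "B2 M" and X = "Bd M" and e = ?e])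
    fix r f assume "0 \<le> r" "\<And>p. p \<in> B2 M \<Longrightarrow> r * \<psi>2 p \<le> \<psi>1 p" "f \<in> Bd M"
    then have "r * \<psi>t2 f \<le> r * choquet2 M \<psi>2 f" "r * choquet2 M \<psi>2 f \<le> choquet2 M \<psi>1 f"
      "choquet2 M \<psi>1 f \<le> \<psi>t1 f"
      by (blast intro: mult_left_mono le1 le2 choquet2_scaled_mono[OF \<psi>])+
    then show "r * \<psi>t2 f \<le> \<psi>t1 f" by linarith
  qed (use nonneg in \<open>blast intro: Bd ext\<close>)+
  ultimately show "(INF p\<in>{p \<in> B2 M. \<psi>2 p > 0}. ereal (\<psi>1 p / \<psi>2 p)) =
        (INF f\<in>{f \<in> Bd M. choquet2 M \<psi>2 f > 0}. ereal (choquet2 M \<psi>1 f / choquet2 M \<psi>2 f)) \<and>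
      (INF f\<in>{f \<in> Bd M. choquet2 M \<psi>2 f > 0}. ereal (choquet2 M \<psi>1 f / choquet2 M \<psi>2 f)) =
        (INF f\<in>{f \<in> Bd M. \<psi>t2 f > 0}. ereal (\<psi>t1 f / \<psi>t2 f))"
    by simp
qed

end
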